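(* Let $q_k,p_k>0$ with $q_k+p_k=1$ for $k\ge2$, and consider the (2,1) random walk $Y$ defined in the context with $Y_0=2$, and its associated $D$, $M$ and matrices $N_k$. Then for every $n\ge2$, $$P(M=n,D<\infty)=\frac{1}{1+\sum_{s=2}^{n-1}\mathbf e_1N_s\cdots N_2\mathbf e_1^t}\cdot\frac{\mathbf e_1N_n\cdots N_2\mathbf e_1^t}{1+\sum_{s=2}^{n}\mathbf e_1N_s\cdots N_2\mathbf e_1^t}.$$
   Context: (2,1) random walk: $Y=\{Y_k\}_{k\ge0}$ is the Markov chain on $\{0,1,2,\dots\}$ with $P(Y_{k+1}=1|Y_k=0)=P(Y_{k+1}=2|Y_k=1)=1$ and, for $n\ge2$, $P(Y_{k+1}=n+1|Y_k=n)=q_n$, $P(Y_{k+1}=n-2|Y_k=n)=p_n$. $D=\inf\{k\ge1:Y_k<Y_0\}$ (with $\inf\emptyset=\infty$) and $M=\sup\{Y_k:0\le k\le D\}$. $N_k=\begin{pmatrix}\theta_k&\theta_k\\1&0\end{pmatrix}$ with $\theta_k=p_k/q_k$, $k\ge2$. $\mathbf e_1=(1,0)$ (row vector), $^t$ is transpose. $N_s\cdots N_2$ is the product in decreasing order of indices; an empty sum is $0$. *)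

theory Defs
  imports "HOL-Probability.Probability"
begin

definition markov_chain :: "'w measure \<Rightarrow> ('s \<Rightarrow> 's \<Rightarrow> real) \<Rightarrow> (nat \<Rightarrow> 'w \<Rightarrow> 's) \<Rightarrow> bool" where
  "markov_chain \<Omega> K Y \<longleftrightarrow>
     prob_space \<Omega> \<and>
     (\<forall>k. Y k \<in> measurable \<Omega> (count_space UNIV)) \<and>
     (\<forall>k x y. \<P>(\<omega> in \<Omega>. \<forall>i\<le>k. Y i \<omega> = x i) > 0 \<longrightarrow>
        \<P>(\<omega> in \<Omega>. Y (Suc k) \<omega> = y \<bar> \<forall>i\<le>k. Y i \<omega> = x i) = K (x k) y)"

definition rw21_kernel :: "(nat \<Rightarrow> real) \<Rightarrow> (nat \<Rightarrow> real) \<Rightarrow> nat \<Rightarrow> nat \<Rightarrow> real" where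
  "rw21_kernel p q x y =
     (if x = 0 then (if y = 1 then 1 else 0)
      else if x = 1 then (if y = 2 then 1 else 0)
      else if y = x + 1 then q x
      else if y = x - 2 then p x
      else 0)"

definition rw21 :: "'w measure \<Rightarrow> (nat \<Rightarrow> real) \<Rightarrow> (nat \<Rightarrow> real) \<Rightarrow> (nat \<Rightarrow> 'w \<Rightarrow> nat) \<Rightarrow> bool" where
  "rw21 \<Omega> p q Y \<longleftrightarrow> markov_chain \<Omega> (rw21_kernel p q) Y"

text \<open>On \<^typ>\<open>enat\<close>, the infimum of the empty set is \<open>\<infinity>\<close>, and the supremum of an
  unbounded set is \<open>\<infinity>\<close>.\<close>

definition first_descent :: "(nat \<Rightarrow> 'w \<Rightarrow> nat) \<Rightarrow> 'w \<Rightarrow> enat" where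
  "first_descent Y \<omega> = Inf {enat k | k. k \<ge> 1 \<and> Y k \<omega> < Y 0 \<omega>}"

definition excursion_max :: "(nat \<Rightarrow> 'w \<Rightarrow> nat) \<Rightarrow> 'w \<Rightarrow> enat" where
  "excursion_max Y \<omega> = Sup {enat (Y k \<omega>) | k. enat k \<le> first_descent Y \<omega>}"

definition theta :: "(nat \<Rightarrow> real) \<Rightarrow> (nat \<Rightarrow> real) \<Rightarrow> nat \<Rightarrow> real" where
  "theta p q k = p k / q k"

definition Nmat :: "(nat \<Rightarrow> real) \<Rightarrow> (nat \<Rightarrow> real) \<Rightarrow> nat \<Rightarrow> real^2^2" where
  "Nmat p q k = vector [vector [theta p q k, theta p q k], vector [1, 0]]"

text \<open>The fold multiplies on the left, so for \<open>s \<ge> 2\<close> this is the product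
  \<open>N\<^sub>s ** \<dots> ** N\<^sub>2\<close> with decreasing indices.\<close>

definition Nprod :: "(nat \<Rightarrow> real) \<Rightarrow> (nat \<Rightarrow> real) \<Rightarrow> nat \<Rightarrow> real^2^2" where
  "Nprod p q s = fold (\<lambda>k A. Nmat p q k ** A) [2..<Suc s] (mat 1)"

definition e1 :: "real^2" where
  "e1 = vector [1, 0]"

text \<open>The scalar \<open>e\<^sub>1 N\<^sub>s \<dots> N\<^sub>2 e\<^sub>1\<^sup>t\<close>.\<close>

definition e1Ne1 :: "(nat \<Rightarrow> real) \<Rightarrow> (nat \<Rightarrow> real) \<Rightarrow> nat \<Rightarrow> real" where
  "e1Ne1 p q s = (e1 v* Nprod p q s) \<bullet> e1"

end

theory Submission imports Defs begin

text \<open>The function \<open>H x = (\<Sum>s=1..<x. e1Ne1 p q s)\<close> satisfies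
  \<open>q x * H (x + 1) + p x * H (x - 2) = H x\<close> for \<open>x \<ge> 2\<close>, because its increments obey the
  recursion encoded by the matrices \<open>N\<^sub>k\<close>, and it vanishes at \<open>0\<close> and \<open>1\<close>. Optional stopping
  at the exit from \<open>{2..<m}\<close> therefore shows that the walk started at \<open>2\<close> hits \<open>m\<close> before
  descending with probability \<open>1 / H m\<close>. Almost surely, \<open>M = n\<close> and \<open>D < \<infinity>\<close> means that \<open>n\<close> is
  hit before the descent but \<open>n + 1\<close> is not; upward steps have size \<open>1\<close>, so these events are
  nested and the probability is \<open>1 / H n - 1 / H (n + 1)\<close>. That the exit is almost surely finite
  follows from a bounded function on \<open>{0..m}\<close> whose drift is constantly \<open>1\<close>.\<close>

section \<open>Laws of a Markov chain at the exit from a set\<close>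

text \<open>For \<open>x\<close> outside \<open>S\<close> this is the probability that the first
  exit from \<open>S\<close> happens at time \<open>k\<close> and at \<open>x\<close>; for
  \<open>x\<close> in \<open>S\<close> it is the mass at \<open>x\<close> of the chain killed on
  leaving \<open>S\<close>.\<close>

definition exit_law :: "'w measure \<Rightarrow> (nat \<Rightarrow> 'w \<Rightarrow> 's) \<Rightarrow> 's set \<Rightarrow> nat \<Rightarrow> 's \<Rightarrow> real" where
  "exit_law \<Omega> Y S k x = \<P>(\<omega> in \<Omega>. (\<forall>i<k. Y i \<omega> \<in> S) \<and> Y k \<omega> = x)"

lemma exit_law_nonneg [simp]: "exit_law \<Omega> Y S k x \<ge> 0"
  by (simp add: exit_law_def)

lemma pred_path_in:
  fixes Y :: "nat \<Rightarrow> 'w \<Rightarrow> 's"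
  assumes "\<And>k. Y k \<in> measurable \<Omega> (count_space UNIV)"
  shows "Measurable.pred \<Omega> (\<lambda>\<omega>. Y k \<omega> \<in> S)"
    and "Measurable.pred \<Omega> (\<lambda>\<omega>. Y k \<omega> = y)"
    and "Measurable.pred \<Omega> (\<lambda>\<omega>. \<forall>i<k. Y i \<omega> \<in> S)"
    and "Measurable.pred \<Omega> (\<lambda>\<omega>. \<forall>i\<le>k. Y i \<omega> = x i)"
proof -
  show in_S: "Measurable.pred \<Omega> (\<lambda>\<omega>. Y i \<omega> \<in> S)" for i S
    by (rule measurable_compose[OF assms]) simp
  show eq: "Measurable.pred \<Omega> (\<lambda>\<omega>. Y k \<omega> = y)" for k y
    using in_S[of k "{y}"] by simp
  show "Measurable.pred \<Omega> (\<lambda>\<omega>. \<forall>i<k. Y i \<omega> \<in> S)"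
    by (intro pred_intros_countable(1) pred_intros_imp' in_S)
  show "Measurable.pred \<Omega> (\<lambda>\<omega>. \<forall>i\<le>k. Y i \<omega> = x i)"
    by (intro pred_intros_countable(1) pred_intros_imp' eq)
qed

text \<open>The defining property is silent on histories of probability zero; there both sides
  vanish, so the product form holds without a side condition.\<close>

lemma markov_chain_path_step:
  assumes "markov_chain \<Omega> K Y"
  shows "\<P>(\<omega> in \<Omega>. \<forall>i\<le>Suc k. Y i \<omega> = x i) =
    \<P>(\<omega> in \<Omega>. \<forall>i\<le>k. Y i \<omega> = x i) * K (x k) (x (Suc k))"
proof -
  interpret prob_space \<Omega> using assms by (simp add: markov_chain_def)
  have meas [measurable]: "\<And>k. Y k \<in> measurable \<Omega> (count_space UNIV)"
    using assms by (simp add: markov_chain_def)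
  note [measurable] = pred_path_in[OF meas]
  let ?Q = "\<P>(\<omega> in \<Omega>. \<forall>i\<le>k. Y i \<omega> = x i)"
  have eq: "\<P>(\<omega> in \<Omega>. \<forall>i\<le>Suc k. Y i \<omega> = x i) =
      \<P>(\<omega> in \<Omega>. Y (Suc k) \<omega> = x (Suc k) \<and> (\<forall>i\<le>k. Y i \<omega> = x i))"
    by (rule arg_cong[where f = prob]) (auto simp: le_Suc_eq)
  show ?thesis
  proof (cases "?Q > 0")
    case True
    then have "\<P>(\<omega> in \<Omega>. Y (Suc k) \<omega> = x (Suc k) \<bar> \<forall>i\<le>k. Y i \<omega> = x i) = K (x k) (x (Suc k))"
      using assms unfolding markov_chain_def by blast
    then show ?thesis
      using True unfolding eq cond_prob_def by (simp add: field_simps)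
  next
    case False
    then have "?Q = 0" by (simp add: zero_less_measure_iff)
    moreover have "\<P>(\<omega> in \<Omega>. \<forall>i\<le>Suc k. Y i \<omega> = x i) \<le> ?Q"
      by (rule finite_measure_mono) auto
    ultimately have "\<P>(\<omega> in \<Omega>. \<forall>i\<le>Suc k. Y i \<omega> = x i) = 0"
      by (intro antisym) auto
    then show ?thesis by (simp add: \<open>?Q = 0\<close>)
  qed
qed

text \<open>There are only countably many finite paths: each one whose last step has kernel value
  \<open>0\<close> is null, and all of them can be discarded together. Paths are coded as lists
  because lists over a countable type form a countable type.\<close>

lemma markov_chain_AE_step:
  fixes Y :: "nat \<Rightarrow> 'w \<Rightarrow> 's :: countable"
  assumes "markov_chain \<Omega> K Y"
  shows "AE \<omega> in \<Omega>. \<forall>k. K (Y k \<omega>) (Y (Suc k) \<omega>) \<noteq> 0"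
proof -
  interpret prob_space \<Omega> using assms by (simp add: markov_chain_def)
  have meas [measurable]: "\<And>k. Y k \<in> measurable \<Omega> (count_space UNIV)"
    using assms by (simp add: markov_chain_def)
  note [measurable] = pred_path_in[OF meas]
  have "AE \<omega> in \<Omega>. (\<forall>i\<le>Suc k. Y i \<omega> = xs ! i) \<longrightarrow> K (xs ! k) (xs ! Suc k) \<noteq> 0"
    for k and xs :: "'s list"
  proof (cases "K (xs ! k) (xs ! Suc k) = 0")
    case True
    then have "\<P>(\<omega> in \<Omega>. \<forall>i\<le>Suc k. Y i \<omega> = xs ! i) = 0"
      by (simp add: markov_chain_path_step[OF assms, of k "(!) xs"])
    then have "AE \<omega> in \<Omega>. \<not> (\<forall>i\<le>Suc k. Y i \<omega> = xs ! i)"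
      by (subst (asm) prob_Collect_eq_0) auto
    then show ?thesis by eventually_elim blast
  qed auto
  then have "AE \<omega> in \<Omega>. \<forall>k. \<forall>xs. (\<forall>i\<le>Suc k. Y i \<omega> = xs ! i) \<longrightarrow> K (xs ! k) (xs ! Suc k) \<noteq> 0"
    by (simp add: AE_all_countable)
  then show ?thesis
  proof eventually_elim
    case (elim \<omega>)
    show ?case
    proof
      fix k
      define xs where "xs = map (\<lambda>i. Y i \<omega>) [0..<Suc (Suc k)]"
      have nth: "xs ! i = Y i \<omega>" if "i \<le> Suc k" for i
        using that unfolding xs_def by (subst nth_map) (auto simp del: upt_Suc)
      then show "K (Y k \<omega>) (Y (Suc k) \<omega>) \<noteq> 0"
        using elim[rule_format, of k xs] by (simp add: nth)
    qed
  qed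
qed

text \<open>The Markov property conditions on the whole history. As \<open>S\<close> is finite, only
  finitely many histories stay inside it, and the path formula is summed over them.\<close>

lemma markov_chain_exit_law_Suc:
  fixes Y :: "nat \<Rightarrow> 'w \<Rightarrow> 's"
  assumes "markov_chain \<Omega> K Y" and "finite S"
  shows "exit_law \<Omega> Y S (Suc k) y = (\<Sum>x\<in>S. exit_law \<Omega> Y S k x * K x y)"
proof -
  interpret prob_space \<Omega> using assms by (simp add: markov_chain_def)
  have meas [measurable]: "\<And>k. Y k \<in> measurable \<Omega> (count_space UNIV)"
    using assms by (simp add: markov_chain_def)
  note [measurable] = pred_path_in[OF meas]
  have step: "\<P>(\<omega> in \<Omega>. (\<forall>i<k. Y i \<omega> \<in> S) \<and> Y k \<omega> = x \<and> Y (Suc k) \<omega> = y) =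
      exit_law \<Omega> Y S k x * K x y" for x
  proof -
    \<comment> \<open>With extensional functions, distinct elements differ at some index below
      \<open>k\<close>, which makes the path events disjoint.\<close>
    define F where "F = {..<k} \<rightarrow>\<^sub>E S"
    define path where "path f = f(k := x, Suc k := y)" for f :: "nat \<Rightarrow> 's"
    have fin: "finite F" unfolding F_def using assms(2) by (intro finite_PiE) auto
    \<comment> \<open>Used twice: with \<open>j = Suc k\<close> to split the event into paths, and
      with \<open>j = k\<close> to reassemble the sum once \<open>K x y\<close> is factored out. The
      values of \<open>path f\<close> at \<open>k\<close> and \<open>Suc k\<close> do not depend on
      \<open>f\<close>, so any \<open>f0\<close> serves.\<close>
    have decomp: "prob {\<omega> \<in> space \<Omega>. (\<forall>i<k. Y i \<omega> \<in> S) \<and> (\<forall>i\<in>{k..j}. Y i \<omega> = path f0 i)} =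
        (\<Sum>f\<in>F. prob {\<omega> \<in> space \<Omega>. \<forall>i\<le>j. Y i \<omega> = path f i})"
      if j: "j = k \<or> j = Suc k" for j f0
    proof -
      have p0: "path f i = path f0 i" if "i \<in> {k..j}" for f i
        using that j by (auto simp: path_def)
      have "{\<omega> \<in> space \<Omega>. (\<forall>i<k. Y i \<omega> \<in> S) \<and> (\<forall>i\<in>{k..j}. Y i \<omega> = path f0 i)} =
          (\<Union>f\<in>F. {\<omega> \<in> space \<Omega>. \<forall>i\<le>j. Y i \<omega> = path f i})"
      proof (intro equalityI subsetI)
        fix \<omega> assume *: "\<omega> \<in> {\<omega> \<in> space \<Omega>. (\<forall>i<k. Y i \<omega> \<in> S) \<and> (\<forall>i\<in>{k..j}. Y i \<omega> = path f0 i)}"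
        define f where "f = restrict (\<lambda>i. Y i \<omega>) {..<k}"
        have "f \<in> F" using * by (auto simp: f_def F_def)
        moreover have "Y i \<omega> = path f i" if "i \<le> j" for i
        proof (cases "i < k")
          case True
          then show ?thesis by (simp add: path_def f_def)
        next
          case False
          then have "i \<in> {k..j}" using that by simp
          then show ?thesis using * p0[of i f] by simp
        qed
        ultimately show "\<omega> \<in> (\<Union>f\<in>F. {\<omega> \<in> space \<Omega>. \<forall>i\<le>j. Y i \<omega> = path f i})"
          using * by blast
      next
        fix \<omega> assume "\<omega> \<in> (\<Union>f\<in>F. {\<omega> \<in> space \<Omega>. \<forall>i\<le>j. Y i \<omega> = path f i})"
        then obtain f where f: "f \<in> F" "\<omega> \<in> space \<Omega>" "\<And>i. i \<le> j \<Longrightarrow> Y i \<omega> = path f i"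
          by blast
        have "Y i \<omega> \<in> S" if "i < k" for i
          using f(1) f(3)[of i] that j by (auto simp: path_def F_def PiE_def Pi_def)
        moreover have "Y i \<omega> = path f0 i" if "i \<in> {k..j}" for i
          using f(3)[of i] p0[OF that, of f] that by simp
        ultimately show "\<omega> \<in> {\<omega> \<in> space \<Omega>. (\<forall>i<k. Y i \<omega> \<in> S) \<and> (\<forall>i\<in>{k..j}. Y i \<omega> = path f0 i)}"
          using f(2) by blast
      qed
      moreover have "disjoint_family_on (\<lambda>f. {\<omega> \<in> space \<Omega>. \<forall>i\<le>j. Y i \<omega> = path f i}) F"
      proof (unfold disjoint_family_on_def, intro ballI impI)
        fix f g assume fg: "f \<in> F" "g \<in> F" "f \<noteq> g"
        then obtain i where i: "i < k" "f i \<noteq> g i"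
          unfolding F_def by (metis PiE_ext lessThan_iff)
        then have "path f i \<noteq> path g i" by (simp add: path_def)
        moreover have "i \<le> j" using i j by auto
        ultimately show "{\<omega> \<in> space \<Omega>. \<forall>i\<le>j. Y i \<omega> = path f i} \<inter>
            {\<omega> \<in> space \<Omega>. \<forall>i\<le>j. Y i \<omega> = path g i} = {}"
          by force
      qed
      ultimately show ?thesis
        by (simp only:) (rule finite_measure_finite_Union[OF fin], auto)
    qed
    have "\<P>(\<omega> in \<Omega>. (\<forall>i<k. Y i \<omega> \<in> S) \<and> Y k \<omega> = x \<and> Y (Suc k) \<omega> = y) =
        prob {\<omega> \<in> space \<Omega>. (\<forall>i<k. Y i \<omega> \<in> S) \<and> (\<forall>i\<in>{k..Suc k}. Y i \<omega> = path undefined i)}"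
      by (rule arg_cong[where f = prob]) (auto simp: path_def atLeastAtMostSuc_conv)
    also have "\<dots> = (\<Sum>f\<in>F. prob {\<omega> \<in> space \<Omega>. \<forall>i\<le>Suc k. Y i \<omega> = path f i})"
      by (rule decomp) simp
    also have "\<dots> = (\<Sum>f\<in>F. prob {\<omega> \<in> space \<Omega>. \<forall>i\<le>k. Y i \<omega> = path f i}) * K x y"
      by (subst markov_chain_path_step[OF assms(1)])
        (simp add: path_def sum_distrib_right)
    also have "(\<Sum>f\<in>F. prob {\<omega> \<in> space \<Omega>. \<forall>i\<le>k. Y i \<omega> = path f i}) =
        prob {\<omega> \<in> space \<Omega>. (\<forall>i<k. Y i \<omega> \<in> S) \<and> (\<forall>i\<in>{k..k}. Y i \<omega> = path undefined i)}"
      by (rule decomp[symmetric]) simp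
    also have "\<dots> = exit_law \<Omega> Y S k x"
      unfolding exit_law_def by (rule arg_cong[where f = prob]) (auto simp: path_def)
    finally show ?thesis .
  qed
  have eq: "{\<omega> \<in> space \<Omega>. (\<forall>i<Suc k. Y i \<omega> \<in> S) \<and> Y (Suc k) \<omega> = y} =
      (\<Union>x\<in>S. {\<omega> \<in> space \<Omega>. (\<forall>i<k. Y i \<omega> \<in> S) \<and> Y k \<omega> = x \<and> Y (Suc k) \<omega> = y})"
    by (auto simp: less_Suc_eq)
  have "exit_law \<Omega> Y S (Suc k) y =
      (\<Sum>x\<in>S. \<P>(\<omega> in \<Omega>. (\<forall>i<k. Y i \<omega> \<in> S) \<and> Y k \<omega> = x \<and> Y (Suc k) \<omega> = y))"
    unfolding exit_law_def eq
  proof (rule finite_measure_finite_Union)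
    have "{\<omega> \<in> space \<Omega>. (\<forall>i<k. Y i \<omega> \<in> S) \<and> Y k \<omega> = x \<and> Y (Suc k) \<omega> = y} \<in> sets \<Omega>" for x
      unfolding pred_def[symmetric] by (intro pred_intros_logic pred_path_in meas)
    then show "(\<lambda>x. {\<omega> \<in> space \<Omega>. (\<forall>i<k. Y i \<omega> \<in> S) \<and> Y k \<omega> = x \<and> Y (Suc k) \<omega> = y}) ` S \<subseteq> sets \<Omega>"
      by blast
    show "disjoint_family_on (\<lambda>x. {\<omega> \<in> space \<Omega>. (\<forall>i<k. Y i \<omega> \<in> S) \<and> Y k \<omega> = x \<and> Y (Suc k) \<omega> = y}) S"
      unfolding disjoint_family_on_def by blast
  qed (rule assms(2))
  then show ?thesis by (simp add: step)
qed

lemma (in prob_space) sum_exit_law: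
  fixes Y :: "nat \<Rightarrow> 'a \<Rightarrow> 's"
  assumes "\<And>k. Y k \<in> measurable M (count_space UNIV)" and "finite S"
  shows "(\<Sum>x\<in>S. exit_law M Y S k x) = \<P>(\<omega> in M. \<forall>i<Suc k. Y i \<omega> \<in> S)"
proof -
  have eq: "{\<omega> \<in> space M. \<forall>i<Suc k. Y i \<omega> \<in> S} =
      (\<Union>x\<in>S. {\<omega> \<in> space M. (\<forall>i<k. Y i \<omega> \<in> S) \<and> Y k \<omega> = x})"
    by (auto simp: less_Suc_eq)
  show ?thesis
    unfolding exit_law_def eq
  proof (rule finite_measure_finite_Union[symmetric])
    have "{\<omega> \<in> space M. (\<forall>i<k. Y i \<omega> \<in> S) \<and> Y k \<omega> = x} \<in> sets M" for x
      unfolding pred_def[symmetric] by (intro pred_intros_logic pred_path_in assms(1))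
    then show "(\<lambda>x. {\<omega> \<in> space M. (\<forall>i<k. Y i \<omega> \<in> S) \<and> Y k \<omega> = x}) ` S \<subseteq> sets M"
      by blast
    show "disjoint_family_on (\<lambda>x. {\<omega> \<in> space M. (\<forall>i<k. Y i \<omega> \<in> S) \<and> Y k \<omega> = x}) S"
      unfolding disjoint_family_on_def by blast
  qed (rule assms(2))
qed

text \<open>Since \<open>x\<close> is outside \<open>S\<close>, being at \<open>x\<close> rules out
  staying in \<open>S\<close> until a later time, so the events for different times are
  disjoint.\<close>

lemma (in prob_space) exit_law_sums:
  fixes Y :: "nat \<Rightarrow> 'a \<Rightarrow> 's"
  assumes "\<And>k. Y k \<in> measurable M (count_space UNIV)" and "x \<notin> S"
  shows "(\<lambda>k. exit_law M Y S k x) sums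
    \<P>(\<omega> in M. \<exists>k. (\<forall>i<k. Y i \<omega> \<in> S) \<and> Y k \<omega> = x)"
proof -
  have "disjoint_family (\<lambda>k. {\<omega> \<in> space M. (\<forall>i<k. Y i \<omega> \<in> S) \<and> Y k \<omega> = x})"
    unfolding disjoint_family_on_def
  proof (intro ballI impI)
    fix j k :: nat assume "j \<noteq> k"
    then show "{\<omega> \<in> space M. (\<forall>i<j. Y i \<omega> \<in> S) \<and> Y j \<omega> = x} \<inter>
        {\<omega> \<in> space M. (\<forall>i<k. Y i \<omega> \<in> S) \<and> Y k \<omega> = x} = {}"
      using assms(2) by (cases j k rule: linorder_cases) auto
  qed
  moreover have "{\<omega> \<in> space M. (\<forall>i<k. Y i \<omega> \<in> S) \<and> Y k \<omega> = x} \<in> sets M" for k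
    unfolding pred_def[symmetric] by (intro pred_intros_logic pred_path_in assms(1))
  then have "range (\<lambda>k. {\<omega> \<in> space M. (\<forall>i<k. Y i \<omega> \<in> S) \<and> Y k \<omega> = x}) \<subseteq> sets M"
    by blast
  ultimately have "(\<lambda>k. prob {\<omega> \<in> space M. (\<forall>i<k. Y i \<omega> \<in> S) \<and> Y k \<omega> = x}) sums
      prob (\<Union>k. {\<omega> \<in> space M. (\<forall>i<k. Y i \<omega> \<in> S) \<and> Y k \<omega> = x})"
    by (intro finite_measure_UNION)
  also have "(\<Union>k. {\<omega> \<in> space M. (\<forall>i<k. Y i \<omega> \<in> S) \<and> Y k \<omega> = x}) =
      {\<omega> \<in> space M. \<exists>k. (\<forall>i<k. Y i \<omega> \<in> S) \<and> Y k \<omega> = x}"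
    by auto
  finally show ?thesis unfolding exit_law_def .
qed

section \<open>Optional stopping for the (2,1) walk\<close>

lemma rw21_kernel_nz:
  "rw21_kernel p q x y \<noteq> 0 \<Longrightarrow> x \<ge> 2 \<Longrightarrow> y = x + 1 \<or> y = x - 2"
  by (auto simp: rw21_kernel_def split: if_splits)

lemma sum_rw21_kernel:
  fixes f :: "nat \<Rightarrow> real"
  assumes "x \<in> {2..<m}"
  shows "(\<Sum>y\<le>m. rw21_kernel p q x y * f y) = q x * f (x + 1) + p x * f (x - 2)"
proof -
  have "(\<Sum>y\<le>m. rw21_kernel p q x y * f y) =
      (\<Sum>y\<in>{x + 1, x - 2}. rw21_kernel p q x y * f y)"
    using assms by (intro sum.mono_neutral_right) (auto simp: rw21_kernel_def)
  also have "\<dots> = q x * f (x + 1) + p x * f (x - 2)"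
    using assms by (auto simp: rw21_kernel_def)
  finally show ?thesis .
qed

text \<open>Optional stopping at the exit from \<open>{2..<m}\<close>, for a function of constant drift \<open>c\<close>.\<close>

lemma rw21_drift:
  fixes H :: "nat \<Rightarrow> real"
  assumes "rw21 \<Omega> p q Y" and "AE \<omega> in \<Omega>. Y 0 \<omega> = 2" and "m \<ge> 2"
    and "H 0 = 0" and "H 1 = 0"
    and drift: "\<And>x. x \<ge> 2 \<Longrightarrow> q x * H (x + 1) + p x * H (x - 2) = H x + c"
  shows "(\<Sum>x\<in>{2..<m}. exit_law \<Omega> Y {2..<m} N x * H x) +
      H m * (\<Sum>k\<le>N. exit_law \<Omega> Y {2..<m} k m) =
    H 2 + c * (\<Sum>k<N. \<P>(\<omega> in \<Omega>. \<forall>i<Suc k. Y i \<omega> \<in> {2..<m}))"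
proof -
  have mc: "markov_chain \<Omega> (rw21_kernel p q) Y" using assms(1) by (simp add: rw21_def)
  interpret prob_space \<Omega> using mc by (simp add: markov_chain_def)
  have meas [measurable]: "\<And>k. Y k \<in> measurable \<Omega> (count_space UNIV)"
    using mc by (simp add: markov_chain_def)
  note [measurable] = pred_path_in[OF meas]
  define u where "u = exit_law \<Omega> Y {2..<m}"
  \<comment> \<open>An exit below \<open>2\<close> ends at \<open>0\<close> or \<open>1\<close>,
    where \<open>H\<close> vanishes, so only the interior and \<open>m\<close> contribute.\<close>
  have split: "(\<Sum>x\<in>{2..<m}. v x * H x) + H m * v m = (\<Sum>x\<le>m. v x * H x)" for v
  proof -
    have "(\<Sum>x\<le>m. v x * H x) = (\<Sum>x\<in>insert m {2..<m}. v x * H x)"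
    proof (rule sum.mono_neutral_right)
      show "\<forall>x\<in>{..m} - insert m {2..<m}. v x * H x = 0"
      proof
        fix x assume "x \<in> {..m} - insert m {2..<m}"
        then have "x = 0 \<or> x = 1" by auto
        then show "v x * H x = 0" using assms(4,5) by auto
      qed
    qed (use assms(3) in auto)
    then show ?thesis by simp
  qed
  show ?thesis
  proof (induction N)
    case 0
    \<comment> \<open>At time \<open>0\<close> the condition on earlier times is empty, so
      \<open>u 0\<close> is the law of \<open>Y 0\<close>, even when \<open>m = 2\<close> and the
      interior is empty.\<close>
    have "u 0 x = of_bool (x = 2)" for x
    proof -
      have "AE \<omega> in \<Omega>. \<omega> \<in> {\<omega> \<in> space \<Omega>. Y 0 \<omega> = x} \<longleftrightarrow> \<omega> \<in> (if x = 2 then space \<Omega> else {})"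
        using assms(2) AE_space by eventually_elim auto
      then have "prob {\<omega> \<in> space \<Omega>. Y 0 \<omega> = x} = prob (if x = 2 then space \<Omega> else {})"
        by (rule finite_measure_eq_AE) auto
      then show ?thesis by (simp add: u_def exit_law_def prob_space)
    qed
    then have "(\<Sum>x\<le>m. u 0 x * H x) = (\<Sum>x\<le>m. if x = 2 then H 2 else 0)"
      by (intro sum.cong) auto
    then show ?case using split[of "u 0"] assms(3) by (simp add: u_def)
  next
    case (Suc N)
    \<comment> \<open>Mass that reached \<open>m\<close> by time \<open>N\<close> is already
      counted; only the mass still inside at time \<open>N\<close> moves on.\<close>
    have "(\<Sum>x\<in>{2..<m}. u (Suc N) x * H x) + H m * u (Suc N) m =
        (\<Sum>y\<le>m. (\<Sum>x\<in>{2..<m}. u N x * rw21_kernel p q x y) * H y)"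
      unfolding split u_def by (simp add: markov_chain_exit_law_Suc[OF mc])
    also have "\<dots> = (\<Sum>x\<in>{2..<m}. u N x * (\<Sum>y\<le>m. rw21_kernel p q x y * H y))"
      unfolding sum_distrib_left sum_distrib_right
      by (subst sum.swap) (simp add: mult.assoc)
    also have "\<dots> = (\<Sum>x\<in>{2..<m}. u N x * (H x + c))"
      by (intro sum.cong refl) (simp add: sum_rw21_kernel drift[symmetric])
    also have "\<dots> = (\<Sum>x\<in>{2..<m}. u N x * H x) + c * (\<Sum>x\<in>{2..<m}. u N x)"
      by (simp add: distrib_left sum.distrib sum_distrib_left mult.commute)
    also have "(\<Sum>x\<in>{2..<m}. u N x) = \<P>(\<omega> in \<Omega>. \<forall>i<Suc N. Y i \<omega> \<in> {2..<m})"
      unfolding u_def by (rule sum_exit_law) auto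
    finally show ?case using Suc.IH unfolding u_def by (simp add: algebra_simps)
  qed
qed

section \<open>Almost sure exit from a bounded interval\<close>

text \<open>The drift equation with \<open>c = 1\<close> at \<open>x = k + 2\<close>, solved for the
  value at \<open>x + 1\<close>, from zero values at \<open>0\<close>, \<open>1\<close> and
  \<open>2\<close>.\<close>

fun unit_drift :: "(nat \<Rightarrow> real) \<Rightarrow> (nat \<Rightarrow> real) \<Rightarrow> nat \<Rightarrow> real" where
  "unit_drift p q (Suc (Suc (Suc k))) = unit_drift p q (Suc (Suc k)) +
     (p (k + 2) * (unit_drift p q (Suc (Suc k)) - unit_drift p q k) + 1) / q (k + 2)"
| "unit_drift p q _ = 0"

text \<open>With \<open>H = unit_drift p q\<close>, the increment from \<open>x\<close> to
  \<open>x + 1\<close> is \<open>(p x * (H x - H (x - 2)) + 1) / q x\<close> for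
  \<open>x \<ge> 2\<close>, nonnegative once the two increments before it are; hence an induction
  hypothesis over all \<open>i \<le> n\<close>.\<close>

lemma unit_drift_mono:
  assumes "\<And>k. k \<ge> 2 \<Longrightarrow> p k > 0" and "\<And>k. k \<ge> 2 \<Longrightarrow> q k > 0"
  shows "mono (unit_drift p q)"
proof -
  have "\<forall>i\<le>n. unit_drift p q i \<le> unit_drift p q (Suc i)" for n
  proof (induction n)
    case 0
    show ?case by (simp add: numeral_2_eq_2)
  next
    case (Suc n)
    have "unit_drift p q (Suc n) \<le> unit_drift p q (Suc (Suc n))"
    proof (cases n)
      case 0
      then show ?thesis by simp
    next
      case (Suc k)
      then have "unit_drift p q k \<le> unit_drift p q (Suc (Suc k))"
        using Suc.IH by (metis le_Suc_eq order.refl order.trans)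
      then show ?thesis
        using assms[of "k + 2"] Suc by simp
    qed
    then show ?case using Suc.IH by (simp add: le_Suc_eq)
  qed
  then show ?thesis by (simp add: mono_iff_le_Suc) blast
qed

lemma unit_drift_step:
  assumes "x \<ge> 2" and "q x > 0" and "q x + p x = 1"
  shows "q x * unit_drift p q (x + 1) + p x * unit_drift p q (x - 2) = unit_drift p q x + 1"
proof -
  obtain k where k: "x = Suc (Suc k)"
    using assms(1) by (metis add_2_eq_Suc le_Suc_ex)
  have "q x * unit_drift p q (x + 1) + p x * unit_drift p q (x - 2) =
      (q x + p x) * unit_drift p q x + 1"
    using assms(2) unfolding k by (simp add: field_simps)
  then show ?thesis by (simp only: assms(3) mult_1)
qed

text \<open>Summed over \<open>k\<close>, these probabilities give the mean exit time from
  \<open>{2..<m}\<close>. The identity \<open>rw21_drift\<close> with \<open>c = 1\<close> bounds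
  the partial sums, so the series converges and its terms tend to \<open>0\<close>.\<close>

lemma rw21_stay_prob_tendsto_0:
  assumes "\<And>k. k \<ge> 2 \<Longrightarrow> p k > 0" and "\<And>k. k \<ge> 2 \<Longrightarrow> q k > 0"
    and "\<And>k. k \<ge> 2 \<Longrightarrow> q k + p k = 1"
    and "rw21 \<Omega> p q Y" and "AE \<omega> in \<Omega>. Y 0 \<omega> = 2" and "m \<ge> 2"
  shows "(\<lambda>k. \<P>(\<omega> in \<Omega>. \<forall>i<Suc k. Y i \<omega> \<in> {2..<m})) \<longlonglongrightarrow> 0"
proof -
  have mc: "markov_chain \<Omega> (rw21_kernel p q) Y" using assms(4) by (simp add: rw21_def)
  interpret prob_space \<Omega> using mc by (simp add: markov_chain_def)
  have meas [measurable]: "\<And>k. Y k \<in> measurable \<Omega> (count_space UNIV)"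
    using mc by (simp add: markov_chain_def)
  note [measurable] = pred_path_in[OF meas]
  define s where "s k = \<P>(\<omega> in \<Omega>. \<forall>i<Suc k. Y i \<omega> \<in> {2..<m})" for k
  define H where "H = unit_drift p q"
  have H: "mono H" "H 0 = 0" "H 1 = 0" "H 2 = 0"
    unfolding H_def using unit_drift_mono[of p q] assms(1,2) by (auto simp: numeral_2_eq_2)
  have Hnn: "H x \<ge> 0" for x using monoD[OF H(1), of 0 x] H(2) by simp
  have sums: "(\<lambda>k. exit_law \<Omega> Y {2..<m} k m) sums
      \<P>(\<omega> in \<Omega>. \<exists>k. (\<forall>i<k. Y i \<omega> \<in> {2..<m}) \<and> Y k \<omega> = m)"
    by (rule exit_law_sums) auto
  \<comment> \<open>One \<open>H m\<close> accounts for the mass still inside at time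
    \<open>N\<close>, the other for the mass that has left at \<open>m\<close>; both masses are at
    most \<open>1\<close>.\<close>
  have bound: "(\<Sum>k<N. s k) \<le> 2 * H m" for N
  proof -
    have "(\<Sum>x\<in>{2..<m}. exit_law \<Omega> Y {2..<m} N x * H x) \<le>
        (\<Sum>x\<in>{2..<m}. exit_law \<Omega> Y {2..<m} N x * H m)"
      by (intro sum_mono mult_left_mono monoD[OF H(1)]) auto
    also have "\<dots> = s N * H m"
      unfolding s_def sum_distrib_right[symmetric] by (subst sum_exit_law) auto
    also have "\<dots> \<le> 1 * H m"
      unfolding s_def by (intro mult_right_mono Hnn) simp
    finally have 1: "(\<Sum>x\<in>{2..<m}. exit_law \<Omega> Y {2..<m} N x * H x) \<le> H m" by simp
    have "(\<Sum>k\<le>N. exit_law \<Omega> Y {2..<m} k m) \<le> (\<Sum>k. exit_law \<Omega> Y {2..<m} k m)"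
      using sums by (intro sum_le_suminf) (auto simp: sums_iff)
    also have "\<dots> \<le> 1" using sums by (simp add: sums_iff)
    finally have 2: "H m * (\<Sum>k\<le>N. exit_law \<Omega> Y {2..<m} k m) \<le> H m * 1"
      by (intro mult_left_mono Hnn)
    have "(\<Sum>x\<in>{2..<m}. exit_law \<Omega> Y {2..<m} N x * H x) +
        H m * (\<Sum>k\<le>N. exit_law \<Omega> Y {2..<m} k m) = H 2 + 1 * (\<Sum>k<N. s k)"
      unfolding s_def
      by (rule rw21_drift[OF assms(4-6)])
        (use H unit_drift_step assms(2,3) in \<open>auto simp: H_def\<close>)
    then show ?thesis using 1 2 H(4) by simp
  qed
  have "summable s"
    by (rule summableI_nonneg_bounded[OF _ bound]) (simp add: s_def)
  then show ?thesis unfolding s_def[symmetric] by (rule summable_LIMSEQ_zero)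
qed

section \<open>Matrix products, the harmonic function and hitting probabilities\<close>

lemma Nprod_Suc: "s \<ge> 1 \<Longrightarrow> Nprod p q (Suc s) = Nmat p q (Suc s) ** Nprod p q s"
  by (simp add: Nprod_def)

lemma e1Ne1_alt: "e1Ne1 p q s = (Nprod p q s *v e1) $ 1"
  by (simp add: e1Ne1_def e1_def inner_vec_def vector_matrix_mult_def
      matrix_vector_mult_def sum_2 vector_2)

text \<open>At index \<open>1\<close> the product is empty. This term of the sum \<open>H\<close>
  supplies the leading \<open>1\<close> in the denominators.\<close>

lemma e1Ne1_1: "e1Ne1 p q (Suc 0) = 1"
  by (simp add: e1Ne1_alt Nprod_def e1_def)

text \<open>The second row of \<open>Nmat\<close> stores the previous first coordinate, so the
  matrix recursion amounts to a scalar recursion of order two.\<close>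

lemma Nprod_e1_Suc:
  assumes "s \<ge> 1"
  shows "(Nprod p q (Suc s) *v e1) $ 1 =
      theta p q (Suc s) * ((Nprod p q s *v e1) $ 1 + (Nprod p q s *v e1) $ 2)"
    and "(Nprod p q (Suc s) *v e1) $ 2 = (Nprod p q s *v e1) $ 1"
proof -
  have "Nprod p q (Suc s) *v e1 = Nmat p q (Suc s) *v (Nprod p q s *v e1)"
    using assms by (simp add: Nprod_Suc matrix_vector_mul_assoc)
  then show "(Nprod p q (Suc s) *v e1) $ 1 =
      theta p q (Suc s) * ((Nprod p q s *v e1) $ 1 + (Nprod p q s *v e1) $ 2)"
    and "(Nprod p q (Suc s) *v e1) $ 2 = (Nprod p q s *v e1) $ 1"
    \<comment> \<open>The instance confines the unfolding to the outer factor and leaves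
      \<open>Nprod p q s *v e1\<close> intact.\<close>
    unfolding Nmat_def matrix_vector_mult_def[of "vector [_, _]"]
    by (simp_all add: sum_2 vector_2 algebra_simps)
qed

text \<open>A separate base case: \<open>e1Ne1 p q 0\<close> is an empty product, hence
  \<open>1\<close>, whereas the second coordinate of \<open>e1\<close> is \<open>0\<close>; so
  \<open>e1Ne1_rec\<close> has no analogue at index \<open>2\<close>.\<close>

lemma e1Ne1_2: "e1Ne1 p q 2 = theta p q 2"
  using Nprod_e1_Suc(1)[of 1 p q]
  by (simp add: e1Ne1_alt Nprod_def e1_def vector_2 numeral_2_eq_2)

lemma e1Ne1_rec:
  "e1Ne1 p q (Suc (Suc (Suc s))) =
    theta p q (Suc (Suc (Suc s))) * (e1Ne1 p q (Suc (Suc s)) + e1Ne1 p q (Suc s))"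
  using Nprod_e1_Suc(1)[of "Suc (Suc s)" p q] Nprod_e1_Suc(2)[of "Suc s" p q]
  by (simp add: e1Ne1_alt)

lemma e1Ne1_nonneg:
  assumes "\<And>k. k \<ge> 2 \<Longrightarrow> p k > 0" and "\<And>k. k \<ge> 2 \<Longrightarrow> q k > 0"
  shows "e1Ne1 p q (Suc s) \<ge> 0"
proof (induction s rule: less_induct)
  case (less s)
  have \<theta>: "theta p q (k + 2) \<ge> 0" for k
    using assms[of "k + 2"] by (simp add: theta_def)
  consider "s = 0" | "s = 1" | t where "s = Suc (Suc t)"
    by (metis One_nat_def not0_implies_Suc)
  then show ?case
  proof cases
    case 1
    then show ?thesis by (simp add: e1Ne1_1)
  next
    case 2
    then show ?thesis using \<theta>[of 0] e1Ne1_2[of p q] by (simp add: numeral_2_eq_2)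
  next
    case 3
    then show ?thesis using \<theta>[of "Suc t"] less[of t] less[of "Suc t"]
      by (simp add: e1Ne1_rec)
  qed
qed

text \<open>With \<open>H\<close> for the sum, \<open>H (x + 1) - H x\<close> is
  \<open>e1Ne1 p q x\<close> and, for \<open>x > 2\<close>, \<open>H x - H (x - 2)\<close> is
  \<open>e1Ne1 p q (x - 1) + e1Ne1 p q (x - 2)\<close>; the claim is then \<open>q x\<close> times
  the recursion. At \<open>x = 2\<close> the second difference is the single term
  \<open>1\<close>.\<close>

lemma e1Ne1_sum_harmonic:
  assumes "x \<ge> 2" and "q x > 0" and "q x + p x = 1"
  shows "q x * (\<Sum>s=1..<x+1. e1Ne1 p q s) + p x * (\<Sum>s=1..<x-2. e1Ne1 p q s) =
    (\<Sum>s=1..<x. e1Ne1 p q s)"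
proof -
  have p: "p x = 1 - q x" using assms(3) by simp
  consider "x = 2" | t where "x = Suc (Suc (Suc t))"
    using assms(1) by (metis add_2_eq_Suc' le_antisym not_less_eq_eq not0_implies_Suc
        numeral_2_eq_2 le_Suc_ex add_2_eq_Suc add.right_neutral)
  then show ?thesis
  proof cases
    case 1
    then show ?thesis
      using assms(2) p e1Ne1_2[of p q]
      by (simp add: numeral_2_eq_2 e1Ne1_1 theta_def field_simps)
  next
    case 2
    have "q x * e1Ne1 p q x = p x * (e1Ne1 p q (Suc (Suc t)) + e1Ne1 p q (Suc t))"
      using assms(2) 2 by (simp add: e1Ne1_rec theta_def)
    then have "q x * (\<Sum>s=1..<x+1. e1Ne1 p q s) + p x * (\<Sum>s=1..<x-2. e1Ne1 p q s) =
        (q x + p x) * (\<Sum>s=1..<x. e1Ne1 p q s)"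
      unfolding 2 by (cases t) (simp_all add: algebra_simps)
    then show ?thesis by (simp only: assms(3) mult_1)
  qed
qed

text \<open>Here \<open>m = 2\<close> is allowed: then the hitting time is \<open>0\<close> and the sum is \<open>e1Ne1 p q 1 = 1\<close>.\<close>

lemma rw21_hit_prob:
  assumes "\<And>k. k \<ge> 2 \<Longrightarrow> p k > 0" and "\<And>k. k \<ge> 2 \<Longrightarrow> q k > 0"
    and "\<And>k. k \<ge> 2 \<Longrightarrow> q k + p k = 1"
    and "rw21 \<Omega> p q Y" and "AE \<omega> in \<Omega>. Y 0 \<omega> = 2" and "m \<ge> 2"
  shows "\<P>(\<omega> in \<Omega>. \<exists>k. (\<forall>i<k. Y i \<omega> \<in> {2..<m}) \<and> Y k \<omega> = m) =
    1 / (\<Sum>s=1..<m. e1Ne1 p q s)"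
proof -
  have mc: "markov_chain \<Omega> (rw21_kernel p q) Y" using assms(4) by (simp add: rw21_def)
  interpret prob_space \<Omega> using mc by (simp add: markov_chain_def)
  have meas [measurable]: "\<And>k. Y k \<in> measurable \<Omega> (count_space UNIV)"
    using mc by (simp add: markov_chain_def)
  note [measurable] = pred_path_in[OF meas]
  define H where "H x = (\<Sum>s=1..<x. e1Ne1 p q s)" for x
  define G where "G = \<P>(\<omega> in \<Omega>. \<exists>k. (\<forall>i<k. Y i \<omega> \<in> {2..<m}) \<and> Y k \<omega> = m)"
  define u where "u = exit_law \<Omega> Y {2..<m}"
  have H2: "H 2 = 1" by (simp add: H_def numeral_2_eq_2 e1Ne1_1)
  have nonneg: "e1Ne1 p q s \<ge> 0" if "s \<ge> 1" for s
    using e1Ne1_nonneg[of p q "s - 1"] assms(1,2) that by simp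
  have Hmono: "H x \<le> H y" if "x \<le> y" for x y
    unfolding H_def using that nonneg by (intro sum_mono2) auto
  \<comment> \<open>\<open>H\<close> has drift \<open>0\<close>, so its mean at the stopped walk
    keeps the initial value \<open>H 2 = 1\<close>.\<close>
  have eq: "(\<Sum>x\<in>{2..<m}. u N x * H x) + H m * (\<Sum>k\<le>N. u k m) = 1" for N
  proof -
    have "(\<Sum>x\<in>{2..<m}. u N x * H x) + H m * (\<Sum>k\<le>N. u k m) =
        H 2 + 0 * (\<Sum>k<N. \<P>(\<omega> in \<Omega>. \<forall>i<Suc k. Y i \<omega> \<in> {2..<m}))"
      unfolding u_def
      by (rule rw21_drift[OF assms(4-6)])
        (use e1Ne1_sum_harmonic assms(2,3) in \<open>auto simp: H_def\<close>)
    then show ?thesis using H2 by simp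
  qed
  \<comment> \<open>The interior part is at most \<open>H m\<close> times the probability of not
    having left, so that in the limit only \<open>H m * G = 1\<close> remains.\<close>
  have rem: "(\<lambda>N. \<Sum>x\<in>{2..<m}. u N x * H x) \<longlonglongrightarrow> 0"
  proof (rule tendsto_sandwich[OF _ _ tendsto_const])
    have Hnn: "0 \<le> H x" for x using Hmono[of 0 x] by (simp add: H_def)
    show "\<forall>\<^sub>F N in sequentially. 0 \<le> (\<Sum>x\<in>{2..<m}. u N x * H x)"
      by (intro always_eventually allI sum_nonneg mult_nonneg_nonneg Hnn) (simp add: u_def)
    have "(\<Sum>x\<in>{2..<m}. u N x * H x) \<le> \<P>(\<omega> in \<Omega>. \<forall>i<Suc N. Y i \<omega> \<in> {2..<m}) * H m" for N
    proof -
      have "(\<Sum>x\<in>{2..<m}. u N x * H x) \<le> (\<Sum>x\<in>{2..<m}. u N x * H m)"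
        by (intro sum_mono mult_left_mono Hmono) (auto simp: u_def)
      also have "\<dots> = \<P>(\<omega> in \<Omega>. \<forall>i<Suc N. Y i \<omega> \<in> {2..<m}) * H m"
        unfolding u_def sum_distrib_right[symmetric] by (subst sum_exit_law) auto
      finally show ?thesis .
    qed
    then show "\<forall>\<^sub>F N in sequentially. (\<Sum>x\<in>{2..<m}. u N x * H x) \<le>
        \<P>(\<omega> in \<Omega>. \<forall>i<Suc N. Y i \<omega> \<in> {2..<m}) * H m"
      by simp
    show "(\<lambda>N. \<P>(\<omega> in \<Omega>. \<forall>i<Suc N. Y i \<omega> \<in> {2..<m}) * H m) \<longlonglongrightarrow> 0"
      by (rule tendsto_mult_left_zero, rule rw21_stay_prob_tendsto_0) (use assms in auto)
  qed
  have "(\<lambda>k. u k m) sums G"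
    unfolding u_def G_def by (rule exit_law_sums) auto
  then have "(\<lambda>N. \<Sum>k\<le>N. u k m) \<longlonglongrightarrow> G"
    by (simp add: sums_def_le)
  from tendsto_add[OF rem tendsto_mult_left[OF this, of "H m"]]
  have "H m * G = 1" by (simp add: eq LIMSEQ_const_iff)
  moreover have "H m \<ge> 1" using Hmono[OF assms(6)] H2 by simp
  ultimately show ?thesis
    unfolding G_def[symmetric] H_def[symmetric] by (simp add: field_simps)
qed

section \<open>Descents and maxima along a path\<close>

text \<open>A nonempty set of \<open>enat\<close> contains its infimum, and the empty set has
  infimum \<open>\<infinity>\<close>, so a finite value is attained.\<close>

lemma first_descent_eq_enat_iff:
  "first_descent Y \<omega> = enat j \<longleftrightarrow>
    j \<ge> 1 \<and> Y j \<omega> < Y 0 \<omega> \<and> (\<forall>i. 1 \<le> i \<and> i < j \<longrightarrow> \<not> Y i \<omega> < Y 0 \<omega>)"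
  (is "?L \<longleftrightarrow> ?R")
proof
  let ?A = "{enat k | k. k \<ge> 1 \<and> Y k \<omega> < Y 0 \<omega>}"
  assume L: ?L
  have "?A \<noteq> {}"
  proof
    assume "?A = {}"
    then have "first_descent Y \<omega> = \<infinity>"
      by (simp only: first_descent_def Inf_empty top_enat_def)
    then show False using L by simp
  qed
  then obtain x where "x \<in> ?A" by (meson equals0I)
  then have "Inf ?A \<in> ?A" by (rule wellorder_InfI)
  then have "enat j \<in> ?A" using L by (simp add: first_descent_def)
  moreover have "\<not> Y i \<omega> < Y 0 \<omega>" if "1 \<le> i" "i < j" for i
  proof
    assume "Y i \<omega> < Y 0 \<omega>"
    then have "Inf ?A \<le> enat i" using that by (intro Inf_lower) auto
    then show False using L that by (simp add: first_descent_def)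
  qed
  ultimately show ?R by auto
next
  assume R: ?R
  show ?L unfolding first_descent_def
  proof (rule antisym)
    show "Inf {enat k | k. k \<ge> 1 \<and> Y k \<omega> < Y 0 \<omega>} \<le> enat j"
      using R by (intro Inf_lower) auto
    show "enat j \<le> Inf {enat k | k. k \<ge> 1 \<and> Y k \<omega> < Y 0 \<omega>}"
    proof (rule Inf_greatest)
      fix x assume "x \<in> {enat k | k. k \<ge> 1 \<and> Y k \<omega> < Y 0 \<omega>}"
      then obtain k where "x = enat k" "k \<ge> 1" "Y k \<omega> < Y 0 \<omega>" by blast
      then show "enat j \<le> x" using R by (metis enat_ord_simps(1) leI)
    qed
  qed
qed

text \<open>Once the descent time is a finite \<open>j\<close>, the supremum runs over finitely many
  values and is attained. The right side combines countably many comparisons at fixed times, which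
  gives measurability.\<close>

lemma excursion_max_eq_iff:
  assumes "n > 0"
  shows "excursion_max Y \<omega> = enat n \<and> first_descent Y \<omega> < \<infinity> \<longleftrightarrow>
    (\<exists>j. first_descent Y \<omega> = enat j \<and> (\<forall>i\<le>j. Y i \<omega> \<le> n) \<and> (\<exists>i\<le>j. Y i \<omega> = n))"
proof -
  have "excursion_max Y \<omega> = enat n \<longleftrightarrow> (\<forall>i\<le>j. Y i \<omega> \<le> n) \<and> (\<exists>i\<le>j. Y i \<omega> = n)"
    if "first_descent Y \<omega> = enat j" for j
  proof -
    have M: "excursion_max Y \<omega> = (SUP i\<in>{..j}. enat (Y i \<omega>))"
      unfolding excursion_max_def that by (rule arg_cong[where f = Sup]) auto
    show ?thesis
    proof
      assume L: "excursion_max Y \<omega> = enat n"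
      have le: "Y i \<omega> \<le> n" if "i \<le> j" for i
        using SUP_upper[of i "{..j}" "\<lambda>i. enat (Y i \<omega>)"] that L M by simp
      moreover have "\<exists>i\<le>j. Y i \<omega> = n"
      proof (rule ccontr)
        assume "\<not> (\<exists>i\<le>j. Y i \<omega> = n)"
        \<comment> \<open>As \<open>n > 0\<close>, the bound \<open>n - 1\<close> is strictly below
          \<open>n\<close>.\<close>
        then have "Y i \<omega> \<le> n - 1" if "i \<le> j" for i using le[OF that] that by fastforce
        then have "excursion_max Y \<omega> \<le> enat (n - 1)"
          unfolding M by (intro SUP_least) auto
        then show False using L assms by simp
      qed
      ultimately show "(\<forall>i\<le>j. Y i \<omega> \<le> n) \<and> (\<exists>i\<le>j. Y i \<omega> = n)" by blast
    next
      assume R: "(\<forall>i\<le>j. Y i \<omega> \<le> n) \<and> (\<exists>i\<le>j. Y i \<omega> = n)"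
      then obtain i where i: "i \<le> j" "Y i \<omega> = n" by blast
      show "excursion_max Y \<omega> = enat n"
        unfolding M
      proof (rule antisym)
        show "(SUP i\<in>{..j}. enat (Y i \<omega>)) \<le> enat n" using R by (intro SUP_least) auto
        show "enat n \<le> (SUP i\<in>{..j}. enat (Y i \<omega>))" using i by (intro SUP_upper2[of i]) auto
      qed
    qed
  qed
  then show ?thesis by (cases "first_descent Y \<omega>") auto
qed

text \<open>Cutting at the first visit of \<open>x\<close> removes \<open>x\<close> from the values
  allowed earlier; this turns a visit of \<open>n\<close> within \<open>{2..<Suc n}\<close> into a
  hit through \<open>{2..<n}\<close>.\<close>

lemma first_hit:
  fixes y :: "nat \<Rightarrow> 's"
  assumes "y k = x" and "\<And>i. i < k \<Longrightarrow> y i \<in> insert x S"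
  shows "\<exists>j\<le>k. y j = x \<and> (\<forall>i<j. y i \<in> S)"
proof -
  define j where "j = (LEAST j. y j = x)"
  have "y j = x" "j \<le> k"
    unfolding j_def using assms(1) by (rule LeastI, rule Least_le)
  moreover have "y i \<in> S" if "i < j" for i
    using assms(2)[of i] not_less_Least[of i "\<lambda>j. y j = x"] that \<open>j \<le> k\<close>
    unfolding j_def by auto
  ultimately show ?thesis by blast
qed

section \<open>The distribution of the maximum\<close>

theorem proposition1:
  fixes p q :: "nat \<Rightarrow> real"
    and \<Omega> :: "'w measure"
    and Y :: "nat \<Rightarrow> 'w \<Rightarrow> nat"
    and n :: nat
  assumes "\<And>k. k \<ge> 2 \<Longrightarrow> p k > 0"
    and "\<And>k. k \<ge> 2 \<Longrightarrow> q k > 0"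
    and "\<And>k. k \<ge> 2 \<Longrightarrow> q k + p k = 1"
    and "rw21 \<Omega> p q Y"
    and "AE \<omega> in \<Omega>. Y 0 \<omega> = 2"
    and "n \<ge> 2"
  shows "\<P>(\<omega> in \<Omega>. excursion_max Y \<omega> = enat n \<and> first_descent Y \<omega> < \<infinity>) =
    1 / (1 + (\<Sum>s=2..n-1. e1Ne1 p q s)) *
    (e1Ne1 p q n / (1 + (\<Sum>s=2..n. e1Ne1 p q s)))"
proof -
  have mc: "markov_chain \<Omega> (rw21_kernel p q) Y" using assms(4) by (simp add: rw21_def)
  interpret prob_space \<Omega> using mc by (simp add: markov_chain_def)
  have meas: "\<And>k. Y k \<in> measurable \<Omega> (count_space UNIV)"
    using mc by (simp add: markov_chain_def)
  define hit where "hit m \<omega> \<longleftrightarrow> (\<exists>k. (\<forall>i<k. Y i \<omega> \<in> {2..<m}) \<and> Y k \<omega> = m)" for m \<omega>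
  define H where "H x = (\<Sum>s=1..<x. e1Ne1 p q s)" for x
  have hit_meas: "{\<omega> \<in> space \<Omega>. hit m \<omega>} \<in> sets \<Omega>" for m
    unfolding hit_def pred_def[symmetric]
    by (intro pred_intros_countable pred_intros_logic pred_path_in meas)
  have event_meas:
    "{\<omega> \<in> space \<Omega>. excursion_max Y \<omega> = enat n \<and> first_descent Y \<omega> < \<infinity>} \<in> sets \<Omega>"
  proof -
    \<comment> \<open>Letting \<open>b\<close> run over the values of \<open>Y j\<close> turns the
      comparison of two times into a countable union of events, each about fixed values or
      sets.\<close>
    have "Measurable.pred \<Omega> (\<lambda>\<omega>. \<exists>b. Y j \<omega> = b \<and> Y i \<omega> \<in> {..<b})" for i j
      by (intro pred_intros_countable pred_intros_logic pred_path_in meas)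
    then have lt: "Measurable.pred \<Omega> (\<lambda>\<omega>. Y i \<omega> < Y j \<omega>)" for i j by simp
    have le: "Measurable.pred \<Omega> (\<lambda>\<omega>. Y i \<omega> \<le> n)" for i
      using pred_path_in(1)[OF meas, where S = "{..n}"] by simp
    have "n > 0" using assms(6) by simp
    show ?thesis
      unfolding excursion_max_eq_iff[OF \<open>n > 0\<close>] first_descent_eq_enat_iff pred_def[symmetric]
      by (intro pred_intros_countable pred_intros_conj1' pred_intros_imp' pred_intros_logic
          pred_path_in(2)[OF meas] lt le) simp_all
  qed
  \<comment> \<open>Staying forever lies in every event of staying up to time \<open>k\<close>,
    whose probability tends to \<open>0\<close>.\<close>
  have exit: "AE \<omega> in \<Omega>. \<exists>k. Y k \<omega> \<notin> {2..<Suc n}"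
  proof -
    let ?s = "\<lambda>k. \<P>(\<omega> in \<Omega>. \<forall>i<Suc k. Y i \<omega> \<in> {2..<Suc n})"
    let ?A = "{\<omega> \<in> space \<Omega>. \<forall>k. Y k \<omega> \<in> {2..<Suc n}}"
    have "prob ?A \<le> ?s k" for k
    proof (rule finite_measure_mono)
      show "{\<omega> \<in> space \<Omega>. \<forall>i<Suc k. Y i \<omega> \<in> {2..<Suc n}} \<in> sets \<Omega>"
        unfolding pred_def[symmetric] by (rule pred_path_in(3)[OF meas])
    qed blast
    moreover have "?s \<longlonglongrightarrow> 0"
      by (rule rw21_stay_prob_tendsto_0) (use assms in auto)
    ultimately have "prob ?A \<le> 0" by (intro LIMSEQ_le_const) blast+
    then have "prob ?A = 0" by (simp only: measure_le_0_iff)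
    moreover have "?A \<in> sets \<Omega>"
      unfolding pred_def[symmetric] by (intro pred_intros_countable pred_path_in meas)
    ultimately have "AE \<omega> in \<Omega>. \<omega> \<notin> ?A" by (simp only: prob_eq_0)
    then show ?thesis using AE_space by eventually_elim blast
  qed
  have step: "AE \<omega> in \<Omega>. \<forall>k. Y k \<omega> \<ge> 2 \<longrightarrow> Y (Suc k) \<omega> = Y k \<omega> + 1 \<or> Y (Suc k) \<omega> = Y k \<omega> - 2"
    using markov_chain_AE_step[OF mc] by eventually_elim (metis rw21_kernel_nz)
  have pathwise: "AE \<omega> in \<Omega>.
      (excursion_max Y \<omega> = enat n \<and> first_descent Y \<omega> < \<infinity> \<longleftrightarrow> hit n \<omega> \<and> \<not> hit (Suc n) \<omega>) \<and>
      (hit (Suc n) \<omega> \<longrightarrow> hit n \<omega>)"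
    using exit step assms(5)
  proof eventually_elim
    case (elim \<omega>)
    define y where "y i = Y i \<omega>" for i
    have y0: "y 0 = 2" using elim(3) by (simp add: y_def)
    have up: "y (Suc i) = y i + 1 \<or> y (Suc i) = y i - 2" if "y i \<ge> 2" for i
      using elim(2) that by (simp add: y_def)
    have hit_iff: "hit m \<omega> \<longleftrightarrow> (\<exists>k. (\<forall>i<k. y i \<in> {2..<m}) \<and> y k = m)" for m
      by (simp add: hit_def y_def)
    have ins: "{2..<Suc n} = insert n {2..<n}" using assms(6) by auto
    have nested: "hit n \<omega>" if "hit (Suc n) \<omega>"
    proof -
      obtain k where k: "\<And>i. i < k \<Longrightarrow> y i \<in> {2..<Suc n}" "y k = Suc n"
        using \<open>hit (Suc n) \<omega>\<close> unfolding hit_iff by blast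
      have "k \<noteq> 0" using k(2) y0 assms(6) by (cases k) auto
      then obtain j where j: "k = Suc j" using not0_implies_Suc by blast
      \<comment> \<open>A downward step from \<open>{2..<Suc n}\<close> cannot reach
        \<open>Suc n\<close>, and an upward one reaches it only from \<open>n\<close>.\<close>
      have "y j = n" using k(1)[of j] k(2) up[of j] j by auto
      moreover have "y i \<in> insert n {2..<n}" if "i < j" for i
        using k(1)[of i] that j unfolding ins by simp
      ultimately show ?thesis using first_hit[of y j n "{2..<n}"] unfolding hit_iff by blast
    qed
    have ex: "\<exists>k. y k \<notin> {2..<Suc n}" using elim(1) by (simp add: y_def)
    \<comment> \<open>At the exit time \<open>T\<close> from \<open>{2..<Suc n}\<close> the path is
      either at \<open>Suc n\<close> or below \<open>2\<close>, by the shape of the steps; these two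
      cases decide the event.\<close>
    define T where "T = (LEAST k. y k \<notin> {2..<Suc n})"
    have T: "y T \<notin> {2..<Suc n}" using ex unfolding T_def by (rule LeastI_ex)
    have before: "y i \<in> {2..<Suc n}" if "i < T" for i
      using not_less_Least[OF that[unfolded T_def]] by simp
    have "T \<noteq> 0"
    proof
      assume "T = 0"
      then show False using T y0 assms(6) by simp
    qed
    then obtain T' where T': "T = Suc T'" using not0_implies_Suc by blast
    have desc: "first_descent Y \<omega> = enat j \<longleftrightarrow>
        j \<ge> 1 \<and> y j < 2 \<and> (\<forall>i. 1 \<le> i \<and> i < j \<longrightarrow> \<not> y i < 2)" for j
      using y0 by (simp add: first_descent_eq_enat_iff y_def)
    have event: "excursion_max Y \<omega> = enat n \<and> first_descent Y \<omega> < \<infinity> \<longleftrightarrow>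
        (\<exists>j. first_descent Y \<omega> = enat j \<and> (\<forall>i\<le>j. y i \<le> n) \<and> (\<exists>i\<le>j. y i = n))"
      using assms(6) by (subst excursion_max_eq_iff) (simp_all add: y_def)
    have "y T' \<in> {2..<Suc n}" using before T' by simp
    then have "y T = Suc n \<or> y T < 2" using T up[of T'] T' by auto
    then have "excursion_max Y \<omega> = enat n \<and> first_descent Y \<omega> < \<infinity> \<longleftrightarrow>
        hit n \<omega> \<and> \<not> hit (Suc n) \<omega>"
    proof
      assume yT: "y T = Suc n"
      then have "hit (Suc n) \<omega>" unfolding hit_iff using before by blast
      \<comment> \<open>The descent can only come after \<open>T\<close>, when \<open>Suc n\<close>
        has already been visited.\<close>
      moreover have "\<not> (\<forall>i\<le>j. y i \<le> n)" if "first_descent Y \<omega> = enat j" for j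
      proof -
        have "y j < 2" using that desc by simp
        then have "T \<le> j" using before[of j] by (cases "j < T") auto
        then show ?thesis using yT by auto
      qed
      ultimately show ?thesis unfolding event by blast
    next
      assume yT: "y T < 2"
      then have D: "first_descent Y \<omega> = enat T"
        unfolding desc using before \<open>T \<noteq> 0\<close> by (auto simp: not_less)
      \<comment> \<open>The descent at \<open>T\<close> ends every initial stretch of values that
        are at least \<open>2\<close>, whatever the upper end \<open>m\<close>.\<close>
      have late: "k \<le> T" if "\<forall>i<k. y i \<in> {2..<m}" for k m
        using that yT by (metis atLeastLessThan_iff leI not_le)
      have "\<not> hit (Suc n) \<omega>"
      proof
        assume "hit (Suc n) \<omega>"
        then obtain k where k: "\<forall>i<k. y i \<in> {2..<Suc n}" "y k = Suc n"
          unfolding hit_iff by blast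
        have "k \<noteq> T" using k(2) yT assms(6) by auto
        then have "k < T" using late[OF k(1)] by simp
        then show False using before[of k] k(2) by simp
      qed
      moreover have "\<forall>i\<le>T. y i \<le> n"
        using before yT assms(6) by (metis atLeastLessThan_iff less_Suc_eq_le nat_less_le
            less_le_trans)
      moreover have "(\<exists>i\<le>T. y i = n) \<longleftrightarrow> hit n \<omega>"
      proof
        assume "\<exists>i\<le>T. y i = n"
        then obtain i where i: "i \<le> T" "y i = n" by blast
        have "y l \<in> insert n {2..<n}" if "l < i" for l
          using before[of l] that i(1) unfolding ins by simp
        then show "hit n \<omega>" using first_hit[of y i n "{2..<n}"] i unfolding hit_iff by blast
      next
        assume "hit n \<omega>"
        then show "\<exists>i\<le>T. y i = n" unfolding hit_iff using late by blast
      qed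
      ultimately show ?thesis unfolding event using D by auto
    qed
    then show ?case using nested by blast
  qed
  have "\<P>(\<omega> in \<Omega>. excursion_max Y \<omega> = enat n \<and> first_descent Y \<omega> < \<infinity>) =
      prob ({\<omega> \<in> space \<Omega>. hit n \<omega>} - {\<omega> \<in> space \<Omega>. hit (Suc n) \<omega>})"
  proof (rule finite_measure_eq_AE)
    show "AE \<omega> in \<Omega>. \<omega> \<in> {\<omega> \<in> space \<Omega>. excursion_max Y \<omega> = enat n \<and> first_descent Y \<omega> < \<infinity>} \<longleftrightarrow>
        \<omega> \<in> {\<omega> \<in> space \<Omega>. hit n \<omega>} - {\<omega> \<in> space \<Omega>. hit (Suc n) \<omega>}"
      using pathwise by eventually_elim blast
  qed (intro event_meas sets.Diff hit_meas)+
  also have "\<dots> = prob {\<omega> \<in> space \<Omega>. hit n \<omega>} -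
      prob ({\<omega> \<in> space \<Omega>. hit n \<omega>} \<inter> {\<omega> \<in> space \<Omega>. hit (Suc n) \<omega>})"
    by (rule finite_measure_Diff'; rule hit_meas)
  also have "prob ({\<omega> \<in> space \<Omega>. hit n \<omega>} \<inter> {\<omega> \<in> space \<Omega>. hit (Suc n) \<omega>}) =
      prob {\<omega> \<in> space \<Omega>. hit (Suc n) \<omega>}"
  proof (rule finite_measure_eq_AE)
    show "AE \<omega> in \<Omega>. \<omega> \<in> {\<omega> \<in> space \<Omega>. hit n \<omega>} \<inter> {\<omega> \<in> space \<Omega>. hit (Suc n) \<omega>} \<longleftrightarrow>
        \<omega> \<in> {\<omega> \<in> space \<Omega>. hit (Suc n) \<omega>}"
      using pathwise by eventually_elim blast
  qed (intro sets.Int hit_meas)+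
  also have "prob {\<omega> \<in> space \<Omega>. hit n \<omega>} = 1 / H n"
    unfolding hit_def H_def by (rule rw21_hit_prob) (use assms in auto)
  also have "prob {\<omega> \<in> space \<Omega>. hit (Suc n) \<omega>} = 1 / H (Suc n)"
    unfolding hit_def H_def by (rule rw21_hit_prob) (use assms in auto)
  finally have P: "\<P>(\<omega> in \<Omega>. excursion_max Y \<omega> = enat n \<and> first_descent Y \<omega> < \<infinity>) =
      1 / H n - 1 / H (Suc n)" .
  \<comment> \<open>The upper bound in \<open>H\<close> is strict, so \<open>H n\<close> and
    \<open>H (Suc n)\<close> are the two denominators.\<close>
  have H_eq: "H (Suc m) = 1 + (\<Sum>s=2..m. e1Ne1 p q s)" if "m \<ge> 1" for m
    using sum.atLeast_Suc_atMost[OF that, of "e1Ne1 p q"]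
    by (simp add: H_def atLeastLessThanSuc_atLeastAtMost e1Ne1_1 numeral_2_eq_2)
  have nonneg: "(\<Sum>s=2..m. e1Ne1 p q s) \<ge> 0" for m
  proof (rule sum_nonneg)
    fix s assume "s \<in> {2..m}"
    then show "e1Ne1 p q s \<ge> 0"
      using e1Ne1_nonneg[of p q "s - 1"] assms(1,2) by simp
  qed
  have H1: "H n = 1 + (\<Sum>s=2..n-1. e1Ne1 p q s)"
    using H_eq[of "n - 1"] assms(6) by simp
  have H2: "H (Suc n) = 1 + (\<Sum>s=2..n. e1Ne1 p q s)"
    using H_eq[of n] assms(6) by simp
  have "H n > 0" "H (Suc n) > 0" using H1 H2 nonneg[of n] nonneg[of "n - 1"] by linarith+
  \<comment> \<open>The difference of reciprocals is
    \<open>(H (Suc n) - H n) / (H n * H (Suc n))\<close>, and its numerator is the one extra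
    term.\<close>
  moreover have "H (Suc n) = H n + e1Ne1 p q n" using assms(6) by (simp add: H_def)
  ultimately have "1 / H n - 1 / H (Suc n) = 1 / H n * (e1Ne1 p q n / H (Suc n))"
    by (simp add: field_simps)
  then show ?thesis unfolding P H1 H2 .
qed

end
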